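(* Let $\mathcal{N}=\{(i,j):\ P_i,P_j \text{ neighbors}\}$. Suppose $s_{ij}<0$ for all $(i,j)\in\mathcal{N}$ and that the mass matrix $\mathcal{M}$ is nondiagonal, i.e. $m_{ij}>0$ for all $(i,j)\in\mathcal{N}$. Let $\tau>0$ and $\omega_0=P(\tau^{-1})$. If $$\omega_0\le\min_{(i,j)\in\mathcal{N}}\frac{|s_{ij}|}{m_{ij}},$$ then the fully discrete solution matrices satisfy $\mathcal{E}_{n,\tau}\ge0$ (elementwise) for all $n\ge1$.
   Context: Characteristic function. One of two cases is assumed. Case I: $P(z)=\sum_{i=1}^m b_iz^{\alpha_i}$, $m\ge1$, $0<\alpha_m<\dots<\alpha_1<1$, $b_i>0$, $b_1=1$. Case II: $P(z)=\int_0^1z^\alpha\mu(\alpha)\,d\alpha$, with $\mu\ge0$ Hölder continuous on $[0,1]$ and $\mu(0)\mu(1)>0$. Finite elements. $\Omega\subset\mathbb{R}^2$ is a bounded polygonal domain, $\mathcal{T}_h$ a (conforming) triangulation of $\Omega$, $X_h\subset H_0^1(\Omega)$ the space of continuous functions that are linear on each triangle of $\mathcal{T}_h$ and vanish on $\partial\Omega$. $P_1,\dots,P_N$ are the interior nodes and $\phi_1,\dots,\phi_N$ the corresponding nodal basis. Two nodes are neighbors if they are distinct and joined by an edge of $\mathcal{T}_h$. The stiffness matrix is $\mathcal{S}=(s_{ij})$, $s_{ij}=\int_\Omega\nabla\phi_j\cdot\nabla\phi_i\,dx$; the mass matrix is $\mathcal{M}=(m_{ij})$, $m_{ij}=[\phi_j,\phi_i]$,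 where $[\cdot,\cdot]$ is an inner product on $X_h$ (approximating the $L^2$ inner product) with $m_{ij}=0$ whenever $i\ne j$ and $P_i,P_j$ are not neighbors. Both matrices are symmetric positive definite, $\mathcal{H}=\mathcal{M}^{-1}\mathcal{S}$, and $\mathcal{I}$ is the identity matrix. Fully discrete scheme. For a time step $\tau>0$ the weights $\omega_j=\omega_j(\tau)$ are defined by $\sum_{j=0}^\infty\omega_j\xi^j=P((1-\xi)/\tau)$, so $\omega_0=P(\tau^{-1})$. The solution matrices $\mathcal{E}_{n,\tau}$ are defined by $U^n=\mathcal{E}_{n,\tau}V$, where $U^0=V$ and, for $n\ge1$, $$U^n=(\omega_0\mathcal{I}+\mathcal{H})^{-1}\Big(\sum_{j=0}^{n-1}\omega_jV-\sum_{j=1}^{n-1}\omega_{n-j}U^j\Big).$$ *)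

theory Defs
  imports "HOL-Analysis.Analysis"
begin

section \<open>The characteristic function and the convolution weights\<close>

text \<open>
  The function \<open>P\<close> is only ever evaluated at positive real arguments here, so it is
  constrained on the positive half-line only.
\<close>

definition multi_term :: "(real \<Rightarrow> real) \<Rightarrow> bool" where
  "multi_term P \<longleftrightarrow>
     (\<exists>(m::nat) (b::nat \<Rightarrow> real) (\<alpha>::nat \<Rightarrow> real).
        1 \<le> m \<and>
        (\<forall>i\<in>{1..m}. 0 < \<alpha> i \<and> \<alpha> i < 1) \<and>
        (\<forall>i\<in>{1..m}. \<forall>j\<in>{1..m}. i < j \<longrightarrow> \<alpha> j < \<alpha> i) \<and>
        (\<forall>i\<in>{1..m}. 0 < b i) \<and> b 1 = 1 \<and>
        (\<forall>z>0. P z = (\<Sum>i=1..m. b i * z powr \<alpha> i)))"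

definition holder_continuous_on :: "real set \<Rightarrow> (real \<Rightarrow> real) \<Rightarrow> bool" where
  "holder_continuous_on A f \<longleftrightarrow>
     (\<exists>C \<gamma>. 0 < \<gamma> \<and> \<gamma> \<le> 1 \<and>
        (\<forall>x\<in>A. \<forall>y\<in>A. \<bar>f x - f y\<bar> \<le> C * \<bar>x - y\<bar> powr \<gamma>))"

definition distributed_order :: "(real \<Rightarrow> real) \<Rightarrow> bool" where
  "distributed_order P \<longleftrightarrow>
     (\<exists>\<mu>::real \<Rightarrow> real.
        (\<forall>\<alpha>\<in>{0..1}. 0 \<le> \<mu> \<alpha>) \<and>
        holder_continuous_on {0..1} \<mu> \<and>
        0 < \<mu> 0 * \<mu> 1 \<and>
        (\<forall>z>0. P z = integral {0..1} (\<lambda>\<alpha>. z powr \<alpha> * \<mu> \<alpha>)))"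

text \<open>
  The generating function identity determines the weights uniquely. For \<open>\<bar>\<xi>\<bar> < 1\<close> the
  argument \<open>(1 - \<xi>) / \<tau>\<close> is positive.
\<close>

definition convolution_weights :: "(real \<Rightarrow> real) \<Rightarrow> real \<Rightarrow> (nat \<Rightarrow> real) \<Rightarrow> bool" where
  "convolution_weights P \<tau> \<omega> \<longleftrightarrow>
     (\<forall>\<xi>. \<bar>\<xi>\<bar> < 1 \<longrightarrow> (\<lambda>j. \<omega> j * \<xi> ^ j) sums P ((1 - \<xi>) / \<tau>))"

lemma convolution_weights_0:
  assumes "convolution_weights P \<tau> \<omega>"
  shows "\<omega> 0 = P (1 / \<tau>)"
proof -
  have "(\<lambda>j. \<omega> j * 0 ^ j) sums P ((1 - 0) / \<tau>)"
    using assms unfolding convolution_weights_def by (metis abs_zero zero_less_one)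
  moreover have "(\<lambda>j. \<omega> j * 0 ^ j) sums \<omega> 0"
    by (rule powser_sums_zero)
  ultimately show ?thesis
    using sums_unique2 by force
qed


section \<open>Piecewise linear finite elements in the plane\<close>

definition polygonal_domain :: "(real^2) set \<Rightarrow> bool" where
  "polygonal_domain \<Omega> \<longleftrightarrow>
     \<Omega> \<noteq> {} \<and> open \<Omega> \<and> connected \<Omega> \<and> bounded \<Omega> \<and>
     (\<exists>L. finite L \<and> frontier \<Omega> = (\<Union>(a, b)\<in>L. closed_segment a b))"

text \<open>
  Conformity is part of the library notion \<^const>\<open>triangulation\<close>: any two members meet
  in a common face of both.
\<close>

definition triangulation_of :: "(real^2) set set \<Rightarrow> (real^2) set \<Rightarrow> bool" where
  "triangulation_of \<T> \<Omega> \<longleftrightarrow>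
     triangulation \<T> \<and> (\<forall>T\<in>\<T>. 2 simplex T) \<and> \<Union>\<T> = closure \<Omega>"

definition interior_nodes :: "(real^2) set set \<Rightarrow> (real^2) set \<Rightarrow> (real^2) set" where
  "interior_nodes \<T> \<Omega> = {p \<in> \<Omega>. \<exists>T\<in>\<T>. p extreme_point_of T}"

definition neighbors :: "(real^2) set set \<Rightarrow> real^2 \<Rightarrow> real^2 \<Rightarrow> bool" where
  "neighbors \<T> p q \<longleftrightarrow> p \<noteq> q \<and> (\<exists>T\<in>\<T>. closed_segment p q edge_of T)"

definition neighbor_pairs :: "(real^2) set set \<Rightarrow> ('n \<Rightarrow> real^2) \<Rightarrow> ('n \<times> 'n) set" where
  "neighbor_pairs \<T> p = {(i, j). neighbors \<T> (p i) (p j)}"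

text \<open>
  Elements of the finite element space are extended by zero to the whole plane, so that
  equality of functions is equality of elements of the space.
\<close>

definition fe_space :: "(real^2) set set \<Rightarrow> (real^2) set \<Rightarrow> (real^2 \<Rightarrow> real) set" where
  "fe_space \<T> \<Omega> =
     {v. continuous_on (closure \<Omega>) v \<and>
         (\<forall>T\<in>\<T>. \<exists>a c. \<forall>x\<in>T. v x = a \<bullet> x + c) \<and>
         (\<forall>x. x \<notin> \<Omega> \<longrightarrow> v x = 0)}"

definition nodal_basis ::
  "(real^2) set set \<Rightarrow> (real^2) set \<Rightarrow> ('n \<Rightarrow> real^2) \<Rightarrow> ('n \<Rightarrow> real^2 \<Rightarrow> real) \<Rightarrow> bool" where
  "nodal_basis \<T> \<Omega> p \<phi> \<longleftrightarrow>
     (\<forall>i. \<phi> i \<in> fe_space \<T> \<Omega> \<and> (\<forall>j. \<phi> i (p j) = (if i = j then 1 else 0)))"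

definition inner_product_on ::
  "('a \<Rightarrow> real) set \<Rightarrow> (('a \<Rightarrow> real) \<Rightarrow> ('a \<Rightarrow> real) \<Rightarrow> real) \<Rightarrow> bool" where
  "inner_product_on X B \<longleftrightarrow>
     (\<forall>u\<in>X. \<forall>v\<in>X. B u v = B v u) \<and>
     (\<forall>u\<in>X. \<forall>v\<in>X. \<forall>w\<in>X. \<forall>a b. B (\<lambda>x. a * u x + b * v x) w = a * B u w + b * B v w) \<and>
     (\<forall>u\<in>X. u \<noteq> (\<lambda>x. 0) \<longrightarrow> 0 < B u u)"

text \<open>
  The pointwise gradient. A piecewise linear function has one in the interior of every
  triangle, and there it is the weak gradient; its (unspecified) values at points of
  non-differentiability lie on the edges, a null set.
\<close>

definition grad :: "(real^2 \<Rightarrow> real) \<Rightarrow> real^2 \<Rightarrow> real^2" where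
  "grad f x = (THE D. GDERIV f x :> D)"

lemma grad_eq:
  assumes "GDERIV f x :> D"
  shows "grad f x = D"
  unfolding grad_def
proof (rule the_equality)
  show "GDERIV f x :> D" by (rule assms)
next
  fix D' assume "GDERIV f x :> D'"
  with assms have "(\<lambda>h. h \<bullet> D') = (\<lambda>h. h \<bullet> D)"
    unfolding gderiv_def using has_derivative_unique by blast
  then show "D' = D"
    by (metis inner_commute vector_eq_rdot)
qed

definition stiffness_matrix ::
  "(real^2) set \<Rightarrow> ('n::finite \<Rightarrow> real^2 \<Rightarrow> real) \<Rightarrow> real^'n^'n" where
  "stiffness_matrix \<Omega> \<phi> = (\<chi> i j. LINT x:\<Omega>|lebesgue. grad (\<phi> j) x \<bullet> grad (\<phi> i) x)"

definition mass_matrix ::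
  "((real^2 \<Rightarrow> real) \<Rightarrow> (real^2 \<Rightarrow> real) \<Rightarrow> real) \<Rightarrow> ('n::finite \<Rightarrow> real^2 \<Rightarrow> real)
     \<Rightarrow> real^'n^'n" where
  "mass_matrix B \<phi> = (\<chi> i j. B (\<phi> j) (\<phi> i))"


section \<open>The fully discrete scheme\<close>

fun scheme :: "(nat \<Rightarrow> real) \<Rightarrow> real^'n^'n \<Rightarrow> real^'n \<Rightarrow> nat \<Rightarrow> real^'n" where
  "scheme \<omega> H V n =
     (if n = 0 then V
      else matrix_inv (\<omega> 0 *\<^sub>R mat 1 + H) *v
             ((\<Sum>j\<in>{0..<n}. \<omega> j *\<^sub>R V) - (\<Sum>j\<in>{1..<n}. \<omega> (n - j) *\<^sub>R scheme \<omega> H V j)))"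

declare scheme.simps [simp del]

definition solution_matrix :: "(nat \<Rightarrow> real) \<Rightarrow> real^'n^'n \<Rightarrow> nat \<Rightarrow> real^'n^'n" where
  "solution_matrix \<omega> H n = matrix (\<lambda>V. scheme \<omega> H V n)"

lemma linear_scheme: "linear (\<lambda>V. scheme \<omega> H V n)"
proof (induction n rule: less_induct)
  case (less n)
  show ?case
  proof (cases "n = 0")
    case True
    then show ?thesis
      by (simp add: scheme.simps linear_id[unfolded id_def])
  next
    case False
    have "linear (\<lambda>V. \<Sum>j\<in>{1..<n}. \<omega> (n - j) *\<^sub>R scheme \<omega> H V j)"
      by (intro linear_compose_sum ballI linear_compose_scale_right less.IH) auto
    moreover have "linear (\<lambda>V::real^'a. \<Sum>j\<in>{0..<n}. \<omega> j *\<^sub>R V)"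
      by (intro linear_compose_sum ballI linear_compose_scale_right linear_ident)
    ultimately have "linear (\<lambda>V. (\<Sum>j\<in>{0..<n}. \<omega> j *\<^sub>R V)
        - (\<Sum>j\<in>{1..<n}. \<omega> (n - j) *\<^sub>R scheme \<omega> H V j))"
      by (rule linear_compose_sub[rotated])
    from linear_compose[OF this matrix_vector_mul_linear[of "matrix_inv (\<omega> 0 *\<^sub>R mat 1 + H)"]]
    show ?thesis
      using False by (subst scheme.simps) (simp add: o_def)
  qed
qed

lemma solution_matrix_works: "scheme \<omega> H V n = solution_matrix \<omega> H n *v V"
  unfolding solution_matrix_def
  using matrix_works[of "\<lambda>V. scheme \<omega> H V n" V] linear_scheme[of \<omega> H n]
  by (simp add: linear_matrix_vector_mul_eq)

end

theory Submission
  imports Defs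
begin

text \<open>
  With \<open>\<H> = \<M>\<^sup>-\<^sup>1\<S>\<close> the step reads
  \<open>(\<omega>\<^sub>0\<M> + \<S>) U\<^sup>n = \<M> W\<close>, where \<open>W\<close> combines \<open>V\<close> with the weight
  \<open>\<Sum>\<^sub>j\<^sub><\<^sub>n \<omega>\<^sub>j \<ge> 0\<close> and the earlier \<open>U\<^sup>j\<close> with the weights
  \<open>-\<omega>\<^sub>n\<^sub>-\<^sub>j \<ge> 0\<close>. The sign of \<open>\<omega>\<^sub>j\<close> for \<open>j \<ge> 1\<close> is that of the
  coefficients of \<open>(1 - \<xi>)\<^sup>\<alpha>\<close> with \<open>0 \<le> \<alpha> \<le> 1\<close>, of which the generating function is a
  superposition. The bound on \<open>\<omega>\<^sub>0\<close> makes the off-diagonal entries of the positive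
  definite matrix \<open>\<omega>\<^sub>0\<M> + \<S>\<close> nonpositive, so its inverse is nonnegative, and
  induction on \<open>n\<close> applies. Entries of \<open>\<S>\<close> at distinct non-neighbors vanish because on
  every triangle one of the two basis functions is zero.
\<close>

section \<open>The weights\<close>

text \<open>Once all lower coefficients agree, the difference of the two series divided by
  \<open>x ^ k\<close> sums to 0 away from the origin, and its limit at the origin is its constant
  term.\<close>

lemma powser_sums_unique:
  fixes a b :: "nat \<Rightarrow> real"
  assumes r: "r > 0"
    and a: "\<And>x. \<bar>x\<bar> < r \<Longrightarrow> (\<lambda>n. a n * x ^ n) sums f x"
    and b: "\<And>x. \<bar>x\<bar> < r \<Longrightarrow> (\<lambda>n. b n * x ^ n) sums f x"
  shows "a = b"
proof
  fix n
  show "a n = b n"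
  proof (induction n rule: less_induct)
    case (less k)
    define d where "d j = a (j + k) - b (j + k)" for j
    have "(\<lambda>j. d j * x ^ j) sums 0" if "x \<noteq> 0" "norm x < r" for x
    proof -
      have "(\<lambda>n. a n * x ^ n - b n * x ^ n) sums (f x - f x)"
        using that by (intro sums_diff a b) auto
      then have "(\<lambda>j. a (j + k) * x ^ (j + k) - b (j + k) * x ^ (j + k)) sums 0"
        using less.IH sums_split_initial_segment[of "\<lambda>n. a n * x ^ n - b n * x ^ n" 0 k] by simp
      moreover have "a (j + k) * x ^ (j + k) - b (j + k) * x ^ (j + k) = x ^ k * (d j * x ^ j)" for j
        by (simp add: d_def power_add algebra_simps)
      ultimately show ?thesis
        using sums_mult_iff[of "x ^ k" "\<lambda>j. d j * x ^ j" 0] \<open>x \<noteq> 0\<close> by simp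
    qed
    then have "((\<lambda>_::real. 0) \<longlongrightarrow> d 0) (at 0)"
      by (rule powser_limit_0_strong[OF r])
    then have "d 0 = 0"
      by (simp add: tendsto_const_iff)
    then show ?case
      by (simp add: d_def)
  qed
qed

section \<open>Binomial coefficients of orders between 0 and 1\<close>

text \<open>These are the Taylor coefficients of (1 - \<xi>)^a beyond the constant one. Consecutive
  ones have ratio \<open>t\<close> in [0,1], so both bounds propagate from the first of them,
  -a.\<close>

lemma signed_gbinomial_bounds:
  fixes a :: real
  assumes "0 \<le> a" "a \<le> 1"
  shows "-1 \<le> (-1) ^ Suc j * (a gchoose Suc j)" "(-1) ^ Suc j * (a gchoose Suc j) \<le> 0"
proof (induction j)
  case 0
  { case 1 show ?case using assms by simp }
  { case 2 show ?case using assms by simp }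
next
  case (Suc j)
  define c where "c = (-1) ^ Suc j * (a gchoose Suc j)"
  define t where "t = (of_nat (Suc j) - a) / of_nat (Suc (Suc j))"
  have "a gchoose Suc (Suc j) = - t * (a gchoose Suc j)"
    using gbinomial_mult_1[of a "Suc j"] by (simp add: t_def field_simps del: of_nat_Suc)
  then have eq: "(-1) ^ Suc (Suc j) * (a gchoose Suc (Suc j)) = t * c"
    by (simp add: c_def)
  have t: "0 \<le> t" "t \<le> 1"
    using assms by (auto simp: t_def field_simps)
  have c: "-1 \<le> c" "c \<le> 0"
    using Suc by (simp_all add: c_def)
  { case 1
    have "-1 \<le> t * (-1)" using t by simp
    also have "\<dots> \<le> t * c" using t c by (intro mult_left_mono) auto
    finally show ?case by (simp only: eq) }
  { case 2 show ?case unfolding eq using t c by (intro mult_nonneg_nonpos) }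
qed

text \<open>Uniformity in \<open>a\<close> as well as in \<open>j\<close> is what the M-test over
  all orders in [0,1] calls for.\<close>

lemma abs_gbinomial_le_1:
  fixes a :: real
  assumes "0 \<le> a" "a \<le> 1"
  shows "\<bar>a gchoose j\<bar> \<le> 1"
proof (cases j)
  case (Suc k)
  have "\<bar>(-1) ^ Suc k * (a gchoose Suc k)\<bar> \<le> 1"
    using signed_gbinomial_bounds[OF assms, of k] by linarith
  then show ?thesis using Suc by (simp add: abs_mult power_abs)
qed simp

lemma powr_scaled_sums:
  fixes a \<tau> \<xi> :: real
  assumes "0 < \<tau>" "\<bar>\<xi>\<bar> < 1"
  shows "(\<lambda>j. (-1) ^ j * (a gchoose j) * \<tau> powr - a * \<xi> ^ j) sums ((1 - \<xi>) / \<tau>) powr a"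
proof -
  have "(\<lambda>j. (a gchoose j) * (- \<xi>) ^ j) sums (1 + - \<xi>) powr a"
    using assms by (intro gen_binomial_real) simp
  then have "(\<lambda>j. (a gchoose j) * (- \<xi>) ^ j * \<tau> powr - a) sums ((1 + - \<xi>) powr a * \<tau> powr - a)"
    by (rule sums_mult2)
  moreover have "(1 + - \<xi>) powr a * \<tau> powr - a = ((1 - \<xi>) / \<tau>) powr a"
    using assms by (simp add: powr_divide powr_minus field_simps)
  moreover have "(a gchoose j) * (- \<xi>) ^ j * \<tau> powr - a
      = (-1) ^ j * (a gchoose j) * \<tau> powr - a * \<xi> ^ j" for j
    by (subst power_minus) (simp add: mult_ac)
  ultimately show ?thesis
    by simp
qed

text \<open>The sign of given weights can thus be read off from any explicit expansion of the same
  generating function.\<close>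

lemma convolution_weights_unique:
  assumes "convolution_weights P \<tau> \<omega>" "convolution_weights P \<tau> \<omega>'"
  shows "\<omega> = \<omega>'"
  using assms unfolding convolution_weights_def
  by (intro powser_sums_unique[of 1 \<omega> "\<lambda>\<xi>. P ((1 - \<xi>) / \<tau>)"]) auto

section \<open>Case I: finitely many orders\<close>

lemma multi_term_weights_nonpos:
  assumes P: "multi_term P" and \<tau>: "0 < \<tau>" and \<omega>: "convolution_weights P \<tau> \<omega>"
  shows "\<omega> (Suc j) \<le> 0"
proof -
  from P obtain m b \<alpha> where \<alpha>: "\<forall>i\<in>{1..m::nat}. 0 < \<alpha> i \<and> \<alpha> i < 1"
    and b: "\<forall>i\<in>{1..m}. 0 < b i" and P: "\<forall>z>0. P z = (\<Sum>i=1..m. b i * z powr \<alpha> i)"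
    unfolding multi_term_def by blast
  \<comment> \<open>Candidate weights: the superposition of the binomial series of the terms of
    \<open>P\<close>. Uniqueness identifies them with \<open>\<omega>\<close>.\<close>
  define \<omega>' where "\<omega>' j = (\<Sum>i=1..m. b i * ((-1) ^ j * (\<alpha> i gchoose j) * \<tau> powr - \<alpha> i))" for j
  have "convolution_weights P \<tau> \<omega>'"
    unfolding convolution_weights_def
  proof (intro allI impI)
    fix \<xi> :: real
    assume \<xi>: "\<bar>\<xi>\<bar> < 1"
    then have "P ((1 - \<xi>) / \<tau>) = (\<Sum>i=1..m. b i * ((1 - \<xi>) / \<tau>) powr \<alpha> i)"
      using P \<tau> by simp
    moreover have "(\<lambda>j. \<Sum>i=1..m. b i * ((-1) ^ j * (\<alpha> i gchoose j) * \<tau> powr - \<alpha> i * \<xi> ^ j))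
        sums (\<Sum>i=1..m. b i * ((1 - \<xi>) / \<tau>) powr \<alpha> i)"
      by (intro sums_sum sums_mult powr_scaled_sums \<tau> \<xi>)
    ultimately show "(\<lambda>j. \<omega>' j * \<xi> ^ j) sums P ((1 - \<xi>) / \<tau>)"
      by (simp add: \<omega>'_def sum_distrib_right mult.assoc)
  qed
  then have "\<omega> = \<omega>'"
    by (rule convolution_weights_unique[OF \<omega>])
  moreover have "\<omega>' (Suc j) \<le> 0"
    unfolding \<omega>'_def
  proof (rule sum_nonpos)
    fix i assume i: "i \<in> {1..m}"
    then have "(-1) ^ Suc j * (\<alpha> i gchoose Suc j) \<le> 0"
      using \<alpha> by (intro signed_gbinomial_bounds) (auto simp: less_imp_le)
    moreover have "0 \<le> b i" using b i by (simp add: less_imp_le)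
    ultimately show "b i * ((-1) ^ Suc j * (\<alpha> i gchoose Suc j) * \<tau> powr - \<alpha> i) \<le> 0"
      by (metis mult_nonneg_nonpos mult_nonpos_nonneg powr_ge_zero)
  qed
  ultimately show ?thesis by simp
qed

lemma multi_term_pos:
  assumes P: "multi_term P" and z: "0 < z"
  shows "0 < P z"
proof -
  from P obtain m b \<alpha> where m: "1 \<le> m"
    and b: "\<forall>i\<in>{1..m::nat}. 0 < b i" and P: "\<forall>z>0. P z = (\<Sum>i=1..m. b i * z powr \<alpha> i)"
    unfolding multi_term_def by blast
  have "0 < (\<Sum>i=1..m. b i * z powr \<alpha> i)"
    using m b z by (intro sum_pos) auto
  then show ?thesis using P z by simp
qed

section \<open>Case II: a density of orders\<close>

lemma holder_continuous_on_imp_continuous_on: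
  assumes "holder_continuous_on A f"
  shows "continuous_on A f"
  unfolding continuous_on_iff
proof (intro ballI allI impI)
  fix x and e :: real
  assume x: "x \<in> A" and e: "0 < e"
  from assms obtain C g where g: "0 < g" and C: "\<forall>x\<in>A. \<forall>y\<in>A. \<bar>f x - f y\<bar> \<le> C * \<bar>x - y\<bar> powr g"
    unfolding holder_continuous_on_def by blast
  \<comment> \<open>\<open>C\<close> carries no sign condition, hence the maximum with 1;
    \<open>d\<close> solves \<open>K * d powr g = e\<close>.\<close>
  define K where "K = max C 1"
  define d where "d = (e / K) powr (1 / g)"
  have K: "K > 0" "C \<le> K" by (auto simp: K_def)
  have "\<bar>f y - f x\<bar> < e" if y: "y \<in> A" "\<bar>y - x\<bar> < d" for y
  proof -
    have "\<bar>f y - f x\<bar> \<le> C * \<bar>y - x\<bar> powr g"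
      using C x y by blast
    also have "\<dots> \<le> K * \<bar>y - x\<bar> powr g"
      using K by (intro mult_right_mono) auto
    also have "\<dots> < K * d powr g"
      using K g y by (intro mult_strict_left_mono powr_less_mono2) auto
    also have "\<dots> = e"
      using K e g by (simp add: d_def powr_powr)
    finally show ?thesis .
  qed
  moreover have "d > 0"
    using K e by (simp add: d_def)
  ultimately show "\<exists>d>0. \<forall>x'\<in>A. dist x' x < d \<longrightarrow> dist (f x') (f x) < e"
    unfolding dist_real_def by blast
qed

text \<open>The argument for finite sums carries over once series and integral are interchanged,
  which uniform convergence in the order \<alpha> permits.\<close>

lemma distributed_order_weights_nonpos:
  assumes P: "distributed_order P" and \<tau>: "0 < \<tau>" and \<omega>: "convolution_weights P \<tau> \<omega>"
  shows "\<omega> (Suc j) \<le> 0"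
proof -
  from P obtain \<mu> where \<mu>: "\<forall>\<alpha>\<in>{0..1}. 0 \<le> \<mu> \<alpha>" "holder_continuous_on {0..1} \<mu>"
    and P: "\<forall>z>0. P z = integral {0..1} (\<lambda>\<alpha>. z powr \<alpha> * \<mu> \<alpha>)"
    unfolding distributed_order_def by blast
  have cont\<mu> [continuous_intros]: "continuous_on {0..1} \<mu>"
    by (rule holder_continuous_on_imp_continuous_on) (rule \<mu>)
  define c where "c j \<alpha> = (-1) ^ j * (\<alpha> gchoose j) * \<tau> powr - \<alpha> * \<mu> \<alpha>" for j \<alpha>
  define \<omega>' where "\<omega>' j = integral {0..1} (c j)" for j
  \<comment> \<open>Written as a product over a factorial, the binomial coefficient is a polynomial
    in \<alpha>.\<close>
  have contc: "continuous_on {0..1} (c j)" for j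
    unfolding c_def gbinomial_prod_rev using \<tau> by (intro continuous_intros) auto
  have "compact ((\<lambda>\<alpha>. \<tau> powr - \<alpha> * \<mu> \<alpha>) ` {0..1})"
    using \<tau> by (intro compact_continuous_image continuous_intros) auto
  then obtain K where K: "\<And>\<alpha>. \<alpha> \<in> {0..1} \<Longrightarrow> \<bar>\<tau> powr - \<alpha> * \<mu> \<alpha>\<bar> \<le> K"
    by (fastforce dest!: compact_imp_bounded simp: bounded_iff)
  have c_bound: "\<bar>c j \<alpha>\<bar> \<le> K" if "\<alpha> \<in> {0..1}" for j \<alpha>
  proof -
    have "\<bar>c j \<alpha>\<bar> = \<bar>\<alpha> gchoose j\<bar> * \<bar>\<tau> powr - \<alpha> * \<mu> \<alpha>\<bar>"
      by (simp add: c_def abs_mult power_abs)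
    also have "\<dots> \<le> 1 * K"
      using that by (intro mult_mono K abs_gbinomial_le_1) auto
    finally show ?thesis by simp
  qed
  have "convolution_weights P \<tau> \<omega>'"
    unfolding convolution_weights_def
  proof (intro allI impI)
    fix \<xi> :: real
    assume \<xi>: "\<bar>\<xi>\<bar> < 1"
    let ?g = "\<lambda>\<alpha>. ((1 - \<xi>) / \<tau>) powr \<alpha> * \<mu> \<alpha>"
    let ?f = "\<lambda>n \<alpha>. \<Sum>j<n. c j \<alpha> * \<xi> ^ j"
    have "(\<lambda>j. c j \<alpha> * \<xi> ^ j) sums ?g \<alpha>" for \<alpha>
      using sums_mult2[OF powr_scaled_sums[OF \<tau> \<xi>], of \<alpha> "\<mu> \<alpha>"] by (simp add: c_def mult_ac)
    then have g: "?g = (\<lambda>\<alpha>. \<Sum>j. c j \<alpha> * \<xi> ^ j)"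
      by (simp add: sums_iff)
    have "uniform_limit {0..1} ?f ?g sequentially"
      unfolding g
    proof (rule Weierstrass_m_test)
      show "norm (c n \<alpha> * \<xi> ^ n) \<le> K * \<bar>\<xi>\<bar> ^ n" if "\<alpha> \<in> {0..1}" for n \<alpha>
        using c_bound[OF that, of n] by (simp add: abs_mult power_abs mult_right_mono)
      show "summable (\<lambda>n. K * \<bar>\<xi>\<bar> ^ n)"
        using \<xi> by (intro summable_mult summable_geometric) simp
    qed
    moreover have "continuous_on {0..1} (?f n)" for n
      by (intro continuous_intros contc)
    ultimately obtain I J where I: "\<And>n. (?f n has_integral I n) {0..1}"
      and J: "(?g has_integral J) {0..1}" and lim: "I \<longlonglongrightarrow> J"
      by (rule uniform_limit_integral) auto
    have "I = (\<lambda>n. \<Sum>j<n. \<omega>' j * \<xi> ^ j)"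
    proof
      fix n
      have "(?f n has_integral (\<Sum>j<n. \<omega>' j * \<xi> ^ j)) {0..1}"
        unfolding \<omega>'_def
        by (intro has_integral_sum has_integral_mult_left integrable_integral
            integrable_continuous_real contc) simp
      with I show "I n = (\<Sum>j<n. \<omega>' j * \<xi> ^ j)" using has_integral_unique by blast
    qed
    moreover have "J = P ((1 - \<xi>) / \<tau>)"
      using P J \<tau> \<xi> by (simp add: integral_unique)
    ultimately show "(\<lambda>j. \<omega>' j * \<xi> ^ j) sums P ((1 - \<xi>) / \<tau>)"
      using lim by (simp add: sums_def)
  qed
  then have "\<omega> = \<omega>'"
    by (rule convolution_weights_unique[OF \<omega>])
  moreover have "\<omega>' (Suc j) \<le> integral {0..1} (\<lambda>_::real. 0)"
    unfolding \<omega>'_def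
  proof (intro integral_le integrable_continuous_real contc continuous_intros)
    fix \<alpha> :: real assume \<alpha>: "\<alpha> \<in> {0..1}"
    then have "(-1) ^ Suc j * (\<alpha> gchoose Suc j) \<le> 0"
      by (intro signed_gbinomial_bounds) auto
    then show "c (Suc j) \<alpha> \<le> 0"
      unfolding c_def using \<mu>(1) \<alpha> by (metis mult_nonpos_nonneg powr_ge_zero)
  qed
  ultimately show ?thesis by simp
qed

lemma distributed_order_pos:
  assumes P: "distributed_order P" and z: "0 < z"
  shows "0 < P z"
proof -
  from P obtain \<mu> where \<mu>: "\<forall>\<alpha>\<in>{0..1}. 0 \<le> \<mu> \<alpha>" "holder_continuous_on {0..1} \<mu>" "0 < \<mu> 0 * \<mu> 1"
    and P: "\<forall>z>0. P z = integral {0..1} (\<lambda>\<alpha>. z powr \<alpha> * \<mu> \<alpha>)"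
    unfolding distributed_order_def by blast
  have cont\<mu> [continuous_intros]: "continuous_on {0..1} \<mu>"
    by (rule holder_continuous_on_imp_continuous_on) (rule \<mu>)
  let ?f = "\<lambda>\<alpha>. z powr \<alpha> * \<mu> \<alpha>"
  have "continuous_on {0..1} ?f"
    using z by (intro continuous_intros) auto
  moreover have nonneg: "0 \<le> ?f \<alpha>" if "\<alpha> \<in> {0..1}" for \<alpha>
    using \<mu>(1) that by simp
  \<comment> \<open>At order 0 the integrand equals \<open>\<mu> 0\<close>, nonzero by the endpoint
    condition; a continuous nonnegative function with zero integral would vanish there.\<close>
  moreover have "?f 0 \<noteq> 0"
    using z \<mu>(3) by auto
  ultimately have "integral {0..1} ?f \<noteq> 0"
    using integral_eq_0_iff[of 0 1 ?f] by force
  \<comment> \<open>The nonintegrable case is closed by the default value 0 of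
    \<open>integral\<close>.\<close>
  moreover have "0 \<le> integral {0..1} ?f"
    using nonneg by (cases "?f integrable_on {0..1}")
      (auto intro: integral_nonneg simp: not_integrable_integral)
  ultimately show ?thesis using P z by simp
qed

text \<open>
  As \<open>\<omega>\<^sub>j \<le> 0\<close> for \<open>j \<ge> 1\<close>, the partial sums of the generating series at
  \<open>0 < \<xi> < 1\<close> dominate its value, which is nonnegative; then \<open>\<xi> \<rightarrow> 1\<close>.
\<close>

lemma weights_partial_sum_nonneg:
  assumes \<tau>: "0 < \<tau>" and \<omega>: "convolution_weights P \<tau> \<omega>"
    and P: "\<And>z. 0 < z \<Longrightarrow> 0 \<le> P z" and neg: "\<And>j. \<omega> (Suc j) \<le> 0" and n: "1 \<le> n"
  shows "0 \<le> (\<Sum>j<n. \<omega> j)"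
proof -
  have "((\<lambda>\<xi>::real. \<Sum>j<n. \<omega> j * \<xi> ^ j) \<longlongrightarrow> (\<Sum>j<n. \<omega> j * 1 ^ j)) (at_left 1)"
    by (intro tendsto_intros)
  moreover have "eventually (\<lambda>\<xi>. 0 \<le> (\<Sum>j<n. \<omega> j * \<xi> ^ j)) (at_left (1::real))"
    using eventually_at_left_real[OF zero_less_one]
  proof eventually_elim
    case (elim \<xi>)
    then have "(\<lambda>j. \<omega> j * \<xi> ^ j) sums P ((1 - \<xi>) / \<tau>)"
      using \<omega> by (simp add: convolution_weights_def)
    then have tail: "(\<lambda>j. \<omega> (j + n) * \<xi> ^ (j + n)) sums
        (P ((1 - \<xi>) / \<tau>) - (\<Sum>j<n. \<omega> j * \<xi> ^ j))"
      by (rule sums_split_initial_segment)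
    \<comment> \<open>As \<open>n\<close> is at least 1, the tail starts beyond index 0 and
      \<open>neg\<close> covers all its weights.\<close>
    have "\<omega> (j + n) * \<xi> ^ (j + n) \<le> 0" for j
      using neg[of "j + n - 1"] n elim by (intro mult_nonpos_nonneg) auto
    then have "P ((1 - \<xi>) / \<tau>) - (\<Sum>j<n. \<omega> j * \<xi> ^ j) \<le> 0"
      by (rule sums_le[OF _ tail sums_zero])
    moreover have "0 \<le> P ((1 - \<xi>) / \<tau>)"
      using elim \<tau> by (intro P) simp
    ultimately show ?case by linarith
  qed
  ultimately show ?thesis
    using tendsto_lowerbound[OF _ _ trivial_limit_at_left_real] by fastforce
qed


section \<open>Inverse positivity and the scheme\<close>

lemma inverse_nonneg_if_offdiag_nonpos:
  fixes A :: "real^'n^'n"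
  assumes pd: "\<And>x. x \<noteq> 0 \<Longrightarrow> 0 < x \<bullet> (A *v x)"
    and off: "\<And>i j. i \<noteq> j \<Longrightarrow> A $ i $ j \<le> 0"
    and Ax: "\<And>i. 0 \<le> (A *v x) $ i"
  shows "0 \<le> x $ i"
proof -
  \<comment> \<open>Test the equation against the negative part of \<open>x\<close>; then \<open>x + u\<close> is the positive part.\<close>
  define u :: "real^'n" where "u = (\<chi> i. max 0 (- x $ i))"
  have u: "0 \<le> u $ i" "0 \<le> (x + u) $ i" "u $ i * (x + u) $ i = 0" for i
    by (auto simp: u_def max_def)
  have "u \<bullet> (A *v (x + u)) = (\<Sum>i\<in>UNIV. \<Sum>j\<in>UNIV. u $ i * (A $ i $ j * (x + u) $ j))"
    by (simp add: inner_vec_def matrix_vector_mult_def sum_distrib_left)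
  also have "\<dots> \<le> 0"
  proof (intro sum_nonpos)
    fix i j
    \<comment> \<open>Diagonal terms vanish because positive and negative parts have disjoint
      supports; the others inherit the sign of the entry of \<open>A\<close>.\<close>
    show "u $ i * (A $ i $ j * (x + u) $ j) \<le> 0"
    proof (cases "i = j")
      case True
      then show ?thesis using u(3)[of i] by auto
    next
      case False
      then show ?thesis
        using u off by (intro mult_nonneg_nonpos mult_nonpos_nonneg) auto
    qed
  qed
  finally have "u \<bullet> (A *v x) + u \<bullet> (A *v u) \<le> 0"
    by (simp add: matrix_vector_right_distrib inner_add_right)
  moreover have "0 \<le> u \<bullet> (A *v x)"
    using u Ax by (auto simp: inner_vec_def intro!: sum_nonneg)
  ultimately have "u = 0"
    using pd[of u] by linarith
  then have "u $ i = 0" by simp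
  then show ?thesis by (simp add: u_def max_def split: if_splits)
qed

section \<open>Eliminating the inverse matrices from the scheme\<close>

text \<open>\<open>matrix_inv\<close> is a choice term, so a two-sided inverse must be exhibited
  first: a trivial kernel yields a left inverse, which for a square matrix is also a right
  one.\<close>

lemma matrix_inv_mult_if_ker_trivial:
  fixes A :: "real^'n^'n"
  assumes "\<And>x. A *v x = 0 \<Longrightarrow> x = 0"
  shows "A ** matrix_inv A = mat 1"
proof -
  have "\<exists>B. A ** B = mat 1 \<and> B ** A = mat 1"
    using assms matrix_left_invertible_ker[of A] matrix_left_right_inverse by metis
  then show ?thesis
    unfolding matrix_inv_def by (metis (mono_tags, lifting) someI_ex)
qed

text \<open>Multiplication by \<open>M\<close> trades the resolvent matrix for
  \<open>c *\<^sub>R M + S\<close>, whose definiteness also gives the resolvent matrix a trivial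
  kernel.\<close>

lemma resolvent_equation:
  fixes S M :: "real^'n^'n"
  assumes M: "\<And>x. x \<noteq> 0 \<Longrightarrow> 0 < x \<bullet> (M *v x)"
    and A: "\<And>x. x \<noteq> 0 \<Longrightarrow> 0 < x \<bullet> ((c *\<^sub>R M + S) *v x)"
  shows "(c *\<^sub>R M + S) *v (matrix_inv (c *\<^sub>R mat 1 + matrix_inv M ** S) *v y) = M *v y"
proof -
  let ?R = "c *\<^sub>R mat 1 + matrix_inv M ** S"
  have "M ** matrix_inv M = mat 1"
    using M by (intro matrix_inv_mult_if_ker_trivial) force
  then have "M ** ?R = c *\<^sub>R M + S"
    by (simp add: matrix_add_ldistrib matrix_mul_assoc matrix_scalar_ac flip: scalar_matrix_assoc)
  then have eq: "(c *\<^sub>R M + S) *v x = M *v (?R *v x)" for x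
    by (metis matrix_vector_mul_assoc)
  have "?R ** matrix_inv ?R = mat 1"
  proof (rule matrix_inv_mult_if_ker_trivial)
    fix x assume "?R *v x = 0"
    then have "(c *\<^sub>R M + S) *v x = 0" by (simp add: eq)
    then show "x = 0" using A[of x] by force
  qed
  then show ?thesis
    by (metis eq matrix_vector_mul_assoc matrix_vector_mul_lid)
qed

lemma matrix_vector_mult_nonneg:
  fixes M :: "real^'n^'m"
  assumes "\<And>i j. 0 \<le> M $ i $ j" "\<And>j. 0 \<le> y $ j"
  shows "0 \<le> (M *v y) $ i"
  using assms by (auto simp: matrix_vector_mult_def intro!: sum_nonneg)

text \<open>Collects the properties of matrices and weights on which the induction runs; the finite
  element setting enters only through them.\<close>

lemma scheme_nonneg:
  fixes S M :: "real^'n^'n"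
  assumes M: "\<And>x. x \<noteq> 0 \<Longrightarrow> 0 < x \<bullet> (M *v x)" and M_nonneg: "\<And>i j. 0 \<le> M $ i $ j"
    and A: "\<And>x. x \<noteq> 0 \<Longrightarrow> 0 < x \<bullet> ((\<omega> 0 *\<^sub>R M + S) *v x)"
    and off: "\<And>i j. i \<noteq> j \<Longrightarrow> \<omega> 0 * M $ i $ j + S $ i $ j \<le> 0"
    and neg: "\<And>j. \<omega> (Suc j) \<le> 0" and part: "\<And>n. 1 \<le> n \<Longrightarrow> 0 \<le> (\<Sum>j<n. \<omega> j)"
    and V: "\<And>i. 0 \<le> V $ i"
  shows "0 \<le> scheme \<omega> (matrix_inv M ** S) V n $ i"
proof (induction n arbitrary: i rule: less_induct)
  case (less n)
  show ?case
  proof (cases "n = 0")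
    case True
    then show ?thesis using V by (simp add: scheme.simps)
  next
    case False
    let ?U = "scheme \<omega> (matrix_inv M ** S) V"
    define W where "W = (\<Sum>j\<in>{0..<n}. \<omega> j *\<^sub>R V) - (\<Sum>j\<in>{1..<n}. \<omega> (n - j) *\<^sub>R ?U j)"
    have "0 \<le> W $ i" for i
    proof -
      have "W $ i = (\<Sum>j<n. \<omega> j) * V $ i - (\<Sum>j\<in>{1..<n}. \<omega> (n - j) * ?U j $ i)"
        by (simp add: W_def sum_component sum_distrib_right lessThan_atLeast0)
      moreover have "0 \<le> (\<Sum>j<n. \<omega> j) * V $ i"
        using part V False by simp
      moreover have "(\<Sum>j\<in>{1..<n}. \<omega> (n - j) * ?U j $ i) \<le> 0"
      proof (intro sum_nonpos mult_nonpos_nonneg)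
        fix j assume "j \<in> {1..<n}"
        \<comment> \<open>Since \<open>n - j\<close> is at least 1, the weight
          \<open>\<omega> 0\<close>, to which \<open>neg\<close> does not apply, never
          occurs.\<close>
        then show "\<omega> (n - j) \<le> 0" "0 \<le> ?U j $ i"
          using neg[of "n - j - 1"] less.IH by (auto simp: Suc_diff_Suc)
      qed
      ultimately show ?thesis by linarith
    qed
    then have MW: "0 \<le> (M *v W) $ i" for i
      by (intro matrix_vector_mult_nonneg M_nonneg)
    have "?U n = matrix_inv (\<omega> 0 *\<^sub>R mat 1 + matrix_inv M ** S) *v W"
      using False by (subst scheme.simps) (simp add: W_def)
    then have "(\<omega> 0 *\<^sub>R M + S) *v ?U n = M *v W"
      using resolvent_equation[OF M A, of W] by simp
    moreover have "(\<omega> 0 *\<^sub>R M + S) $ i $ j \<le> 0" if "i \<noteq> j" for i j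
      using off[OF that] by simp
    ultimately show ?thesis
      using MW by (intro inverse_nonneg_if_offdiag_nonpos[of "\<omega> 0 *\<^sub>R M + S" "?U n", OF A]) simp_all
  qed
qed


section \<open>The mass matrix\<close>

lemma fe_space_affineE:
  assumes "v \<in> fe_space \<T> \<Omega>" "T \<in> \<T>"
  obtains a c where "\<And>x. x \<in> T \<Longrightarrow> v x = a \<bullet> x + c"
proof -
  have "\<forall>T\<in>\<T>. \<exists>a c. \<forall>x\<in>T. v x = a \<bullet> x + c"
    using assms(1) unfolding fe_space_def mem_Collect_eq by (elim conjE)
  then have "\<exists>a c. \<forall>x\<in>T. v x = a \<bullet> x + c" using assms(2) by (rule bspec)
  then show thesis using that by metis
qed

lemma fe_space_zero: "(\<lambda>x. 0) \<in> fe_space \<T> \<Omega>"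
proof -
  have "\<exists>a c. \<forall>x\<in>T. (0::real) = a \<bullet> x + c" for T :: "(real^2) set"
    by (rule exI[of _ 0], rule exI[of _ 0]) simp
  then show ?thesis by (simp add: fe_space_def)
qed

lemma fe_space_lincomb:
  assumes u: "u \<in> fe_space \<T> \<Omega>" and v: "v \<in> fe_space \<T> \<Omega>"
  shows "(\<lambda>x. a * u x + b * v x) \<in> fe_space \<T> \<Omega>"
proof -
  have "\<exists>d e. \<forall>x\<in>T. a * u x + b * v x = d \<bullet> x + e" if "T \<in> \<T>" for T
  proof -
    obtain d e where "\<And>x. x \<in> T \<Longrightarrow> u x = d \<bullet> x + e"
      using fe_space_affineE[OF u \<open>T \<in> \<T>\<close>] by metis
    moreover obtain d' e' where "\<And>x. x \<in> T \<Longrightarrow> v x = d' \<bullet> x + e'"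
      using fe_space_affineE[OF v \<open>T \<in> \<T>\<close>] by metis
    ultimately have "\<forall>x\<in>T. a * u x + b * v x = (a *\<^sub>R d + b *\<^sub>R d') \<bullet> x + (a * e + b * e')"
      by (simp add: inner_add_left algebra_simps)
    then show ?thesis by blast
  qed
  then show ?thesis
    using u v unfolding fe_space_def by (simp add: continuous_intros)
qed

lemma inner_product_on_linear:
  assumes "inner_product_on X B" "u \<in> X" "v \<in> X" "w \<in> X"
  shows "B (\<lambda>x. a * u x + b * v x) w = a * B u w + b * B v w"
  using assms unfolding inner_product_on_def by blast

text \<open>Membership is proved together with linearity because linearity of \<open>B\<close> at
  each insertion presupposes that the partial sum lies in the space.\<close>

lemma inner_product_on_fe_space_sum:
  assumes B: "inner_product_on (fe_space \<T> \<Omega>) B" and "finite F"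
    and \<phi>: "\<And>i. i \<in> F \<Longrightarrow> \<phi> i \<in> fe_space \<T> \<Omega>" and w: "w \<in> fe_space \<T> \<Omega>"
  shows "(\<lambda>x. \<Sum>i\<in>F. c i * \<phi> i x) \<in> fe_space \<T> \<Omega> \<and>
         B (\<lambda>x. \<Sum>i\<in>F. c i * \<phi> i x) w = (\<Sum>i\<in>F. c i * B (\<phi> i) w)"
  using \<open>finite F\<close> \<phi>
proof (induction F)
  case empty
  have "B (\<lambda>x. 0 * (0::real) + 0 * 0) w = 0 * B (\<lambda>x. 0) w + 0 * B (\<lambda>x. 0) w"
    by (rule inner_product_on_linear[OF B fe_space_zero fe_space_zero w])
  then show ?case by (simp add: fe_space_zero)
next
  case (insert k F)
  let ?v = "\<lambda>x. \<Sum>i\<in>F. c i * \<phi> i x"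
  have v: "?v \<in> fe_space \<T> \<Omega>" "B ?v w = (\<Sum>i\<in>F. c i * B (\<phi> i) w)" "\<phi> k \<in> fe_space \<T> \<Omega>"
    using insert by auto
  have "(\<lambda>x. c k * \<phi> k x + 1 * ?v x) \<in> fe_space \<T> \<Omega>"
    by (intro fe_space_lincomb v)
  moreover have "B (\<lambda>x. c k * \<phi> k x + 1 * ?v x) w = c k * B (\<phi> k) w + 1 * B ?v w"
    by (rule inner_product_on_linear[OF B v(3) v(1) w])
  ultimately show ?case
    using insert.hyps v by simp
qed

text \<open>The quadratic form is \<open>B ?u ?u\<close> for the function with nodal values
  \<open>x\<close>, and a nonzero nodal value makes this function nonzero.\<close>

lemma mass_matrix_pos_def:
  fixes \<phi> :: "'n::finite \<Rightarrow> real^2 \<Rightarrow> real"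
  assumes B: "inner_product_on (fe_space \<T> \<Omega>) B" and \<phi>: "nodal_basis \<T> \<Omega> p \<phi>" and x: "x \<noteq> 0"
  shows "0 < x \<bullet> (mass_matrix B \<phi> *v x)"
proof -
  let ?u = "\<lambda>y. \<Sum>i\<in>UNIV. x $ i * \<phi> i y"
  have \<phi>X: "\<phi> i \<in> fe_space \<T> \<Omega>" for i
    using \<phi> by (simp add: nodal_basis_def)
  have u_sum: "?u \<in> fe_space \<T> \<Omega> \<and> B ?u w = (\<Sum>i\<in>UNIV. x $ i * B (\<phi> i) w)" if "w \<in> fe_space \<T> \<Omega>" for w
    using inner_product_on_fe_space_sum[OF B finite_class.finite_UNIV \<phi>X that, where c = "\<lambda>i. x $ i"] .
  have uX: "?u \<in> fe_space \<T> \<Omega>"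
    using u_sum[OF fe_space_zero] by blast
  obtain k where "x $ k \<noteq> 0"
    using x by (auto simp: vec_eq_iff)
  moreover have "?u (p k) = x $ k"
  proof -
    have "\<phi> i (p k) = (if i = k then 1 else 0)" for i
      using \<phi> by (simp only: nodal_basis_def)
    then have "?u (p k) = (\<Sum>i\<in>UNIV. x $ i * (if i = k then 1 else 0))"
      by (simp only:)
    then show ?thesis
      by (simp add: if_distrib cong: if_cong)
  qed
  ultimately have "?u (p k) \<noteq> (\<lambda>x. 0) (p k)"
    by simp
  then have "?u \<noteq> (\<lambda>x. 0)"
    by (rule contrapos_nn) (rule fun_cong)
  then have "0 < B ?u ?u"
    using B uX unfolding inner_product_on_def by blast
  also have "B ?u ?u = (\<Sum>i\<in>UNIV. x $ i * B ?u (\<phi> i))"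
    using u_sum[OF uX] B uX \<phi>X unfolding inner_product_on_def by simp
  also have "\<dots> = x \<bullet> (mass_matrix B \<phi> *v x)"
    using u_sum[OF \<phi>X] by (simp add: inner_vec_def matrix_vector_mult_def mass_matrix_def mult.commute)
  finally show ?thesis .
qed

text \<open>Complements the hypotheses on the entries of the mass matrix, which concern distinct
  nodes only.\<close>

lemma mass_matrix_diag_pos:
  fixes \<phi> :: "'n::finite \<Rightarrow> real^2 \<Rightarrow> real"
  assumes B: "inner_product_on (fe_space \<T> \<Omega>) B" and \<phi>: "nodal_basis \<T> \<Omega> p \<phi>"
  shows "0 < mass_matrix B \<phi> $ i $ i"
proof -
  have "\<phi> i \<in> fe_space \<T> \<Omega>" "\<phi> i (p i) = 1"
    using \<phi> by (auto simp: nodal_basis_def)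
  moreover from this have "\<phi> i \<noteq> (\<lambda>x. 0)"
    by auto
  ultimately show ?thesis
    using B by (simp add: mass_matrix_def inner_product_on_def)
qed


section \<open>The stiffness matrix\<close>

text \<open>The set on which gradients are locally constant. The intersection with \<Omega> matters:
  triangles are only known to lie in the closure of \<Omega>.\<close>

definition open_triangles :: "(real^2) set set \<Rightarrow> (real^2) set \<Rightarrow> (real^2) set" where
  "open_triangles \<T> \<Omega> = \<Omega> \<inter> (\<Union>T\<in>\<T>. interior T)"

lemma grad_affine_on:
  assumes "\<And>x. x \<in> T \<Longrightarrow> v x = a \<bullet> x + c" and x: "x \<in> interior T"
  shows "grad v x = a"
proof -
  have "((\<lambda>x. a \<bullet> x + c) has_derivative (\<lambda>h. h \<bullet> a)) (at x)"
    by (auto intro!: derivative_eq_intros simp: inner_commute)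
  then have "(v has_derivative (\<lambda>h. h \<bullet> a)) (at x)"
    by (rule has_derivative_transform_within_open[OF _ open_interior x])
      (use assms interior_subset in force)
  then show ?thesis by (intro grad_eq) (simp add: gderiv_def)
qed

lemma triangulation_of_finite: "triangulation_of \<T> \<Omega> \<Longrightarrow> finite \<T>"
  by (simp add: triangulation_of_def triangulation_def)

lemma triangulation_of_simplexE:
  assumes "triangulation_of \<T> \<Omega>" "T \<in> \<T>"
  obtains C where "\<not> affine_dependent C" "T = convex hull C" "finite C"
  using assms unfolding triangulation_of_def simplex by blast

text \<open>The exceptional points lie on the frontiers of finitely many convex sets, each of
  measure zero.\<close>

lemma negligible_diff_open_triangles:
  assumes "triangulation_of \<T> \<Omega>"
  shows "negligible (\<Omega> - open_triangles \<T> \<Omega>)"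
proof (rule negligible_subset)
  show "negligible (\<Union>(frontier ` \<T>))"
  proof (intro negligible_Union finite_imageI)
    show "finite \<T>" using assms by (rule triangulation_of_finite)
    fix F assume "F \<in> frontier ` \<T>"
    then show "negligible F"
      using assms by (auto elim!: triangulation_of_simplexE intro!: negligible_convex_frontier)
  qed
  have "\<Omega> \<subseteq> \<Union>\<T>"
    using assms closure_subset[of \<Omega>] by (auto simp: triangulation_of_def)
  moreover have "T \<subseteq> interior T \<union> frontier T" for T :: "(real^2) set"
    using closure_subset[of T] by (auto simp: frontier_def)
  ultimately show "\<Omega> - open_triangles \<T> \<Omega> \<subseteq> \<Union>(frontier ` \<T>)"
    unfolding open_triangles_def by blast
qed

text \<open>The integrand is constant on each of finitely many bounded open triangles. Integrability
  excludes that stiffness entries are mere default values of the integral.\<close>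

lemma grad_inner_integrable:
  assumes \<Omega>: "open \<Omega>" and \<T>: "triangulation_of \<T> \<Omega>"
    and u: "u \<in> fe_space \<T> \<Omega>" and v: "v \<in> fe_space \<T> \<Omega>"
  shows "set_integrable lebesgue \<Omega> (\<lambda>x. grad u x \<bullet> grad v x)"
proof -
  let ?f = "\<lambda>x. grad u x \<bullet> grad v x"
  have "set_integrable lebesgue (interior T) ?f" if T: "T \<in> \<T>" for T
  proof -
    obtain a c where "\<And>x. x \<in> T \<Longrightarrow> u x = a \<bullet> x + c"
      using fe_space_affineE[OF u T] by metis
    moreover obtain b d where "\<And>x. x \<in> T \<Longrightarrow> v x = b \<bullet> x + d"
      using fe_space_affineE[OF v T] by metis
    ultimately have "?f x = a \<bullet> b" if "x \<in> interior T" for x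
      using that by (metis grad_affine_on)
    then have "set_integrable lebesgue (interior T) ?f
        = set_integrable lebesgue (interior T) (\<lambda>x. a \<bullet> b)"
      by (intro set_integrable_cong) auto
    moreover have "bounded T"
      using \<T> T by (auto elim!: triangulation_of_simplexE intro: bounded_convex_hull finite_imp_bounded)
    ultimately show ?thesis
      using lmeasurable_interior[of T] by (simp add: absolutely_integrable_on_const)
  qed
  then have "set_integrable lebesgue (\<Union>T\<in>\<T>. interior T) ?f"
    using triangulation_of_finite[OF \<T>] by (intro set_integrable_UN) auto
  then have "set_integrable lebesgue (open_triangles \<T> \<Omega>) ?f"
    by (rule set_integrable_subset)
      (use \<Omega> in \<open>auto simp: open_triangles_def intro!: sets_completionI_sets borel_open open_Int open_UN\<close>)
  \<comment> \<open>Integrability passes to \<Omega> because the two sets differ by a null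
    set.\<close>
  moreover have "negligible {x \<in> \<Omega> - open_triangles \<T> \<Omega>. ?f x \<noteq> 0}"
    by (rule negligible_subset[OF negligible_diff_open_triangles[OF \<T>]]) auto
  moreover have "negligible {x \<in> open_triangles \<T> \<Omega> - \<Omega>. ?f x \<noteq> 0}"
    by (rule negligible_subset[OF negligible_empty]) (auto simp: open_triangles_def)
  ultimately show ?thesis
    using absolutely_integrable_spike_set_eq[of \<Omega> "open_triangles \<T> \<Omega>" ?f] by blast
qed

text \<open>The quadratic form is the integral of the square of \<open>?g\<close>. Combining
  gradients, instead of taking the gradient of the combination, avoids linearity of
  \<open>grad\<close>, which is in doubt where its values are unspecified.\<close>

lemma stiffness_matrix_pos_semidef:
  fixes \<phi> :: "'n::finite \<Rightarrow> real^2 \<Rightarrow> real"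
  assumes \<Omega>: "open \<Omega>" and \<T>: "triangulation_of \<T> \<Omega>"
    and \<phi>: "\<And>i. \<phi> i \<in> fe_space \<T> \<Omega>"
  shows "0 \<le> x \<bullet> (stiffness_matrix \<Omega> \<phi> *v x)"
proof -
  let ?g = "\<lambda>y. \<Sum>i\<in>UNIV. x $ i *\<^sub>R grad (\<phi> i) y"
  note int = grad_inner_integrable[OF \<Omega> \<T> \<phi> \<phi>]
  have g: "?g y \<bullet> ?g y = (\<Sum>i\<in>UNIV. \<Sum>j\<in>UNIV. x $ i * (x $ j * (grad (\<phi> j) y \<bullet> grad (\<phi> i) y)))" for y
    by (simp add: inner_sum_left inner_sum_right inner_commute sum_distrib_left mult.left_commute)
  have "((\<lambda>y. ?g y \<bullet> ?g y) has_integral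
      (\<Sum>i\<in>UNIV. \<Sum>j\<in>UNIV. x $ i * (x $ j * stiffness_matrix \<Omega> \<phi> $ i $ j))) \<Omega>"
    unfolding g stiffness_matrix_def vec_lambda_beta
    by (intro has_integral_sum has_integral_mult_right has_integral_set_lebesgue int) simp_all
  then have "0 \<le> (\<Sum>i\<in>UNIV. \<Sum>j\<in>UNIV. x $ i * (x $ j * stiffness_matrix \<Omega> \<phi> $ i $ j))"
    by (rule has_integral_nonneg) (rule inner_ge_zero)
  then show ?thesis
    by (simp add: inner_vec_def matrix_vector_mult_def sum_distrib_left mult_ac)
qed

section \<open>Locality of the nodal basis\<close>

text \<open>An affine function vanishing at the vertices vanishes on the triangle. Each vertex is
  either another interior node or outside \<Omega>, where the whole space vanishes.\<close>

lemma nodal_basis_zero_on_triangle: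
  fixes \<phi> :: "'n \<Rightarrow> real^2 \<Rightarrow> real"
  assumes \<T>: "triangulation_of \<T> \<Omega>" and p: "bij_betw p UNIV (interior_nodes \<T> \<Omega>)"
    and \<phi>: "nodal_basis \<T> \<Omega> p \<phi>" and T: "T \<in> \<T>" and i: "\<not> p i extreme_point_of T"
    and x: "x \<in> T"
  shows "\<phi> i x = 0"
proof -
  from \<T> T obtain C where C: "\<not> affine_dependent C" "T = convex hull C"
    by (rule triangulation_of_simplexE)
  have ext: "y extreme_point_of T \<longleftrightarrow> y \<in> C" for y
    using C extreme_point_of_convex_hull_affine_independent by blast
  have \<phi>X: "\<phi> i \<in> fe_space \<T> \<Omega>"
    using \<phi> by (simp add: nodal_basis_def)
  then obtain a c where a: "\<And>x. x \<in> T \<Longrightarrow> \<phi> i x = a \<bullet> x + c"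
    using fe_space_affineE[OF _ T] by metis
  have "C \<subseteq> {y. a \<bullet> y = - c}"
  proof
    fix y assume y: "y \<in> C"
    have "\<phi> i y = 0"
    proof (cases "y \<in> \<Omega>")
      case True
      then have "y \<in> interior_nodes \<T> \<Omega>"
        using y T ext by (auto simp: interior_nodes_def)
      then obtain k where k: "y = p k"
        using p by (auto simp: bij_betw_def)
      then have "k \<noteq> i" using y i ext by auto
      then show ?thesis using \<phi> k by (auto simp: nodal_basis_def)
    next
      case False
      then show ?thesis using \<phi>X by (simp add: fe_space_def)
    qed
    moreover have "y \<in> T" using y C hull_inc by metis
    ultimately show "y \<in> {y. a \<bullet> y = - c}" using a by fastforce
  qed
  \<comment> \<open>The zero set of an affine function is convex, even if \<open>a = 0\<close>, so
    it contains the hull of the vertices.\<close>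
  then have "T \<subseteq> {y. a \<bullet> y = - c}"
    unfolding C by (intro hull_minimal convex_hyperplane)
  then show ?thesis using a x by fastforce
qed

lemma stiffness_matrix_non_neighbors:
  fixes \<phi> :: "'n::finite \<Rightarrow> real^2 \<Rightarrow> real"
  assumes \<T>: "triangulation_of \<T> \<Omega>"
    and p: "bij_betw p UNIV (interior_nodes \<T> \<Omega>)" and \<phi>: "nodal_basis \<T> \<Omega> p \<phi>"
    and ij: "i \<noteq> j" "\<not> neighbors \<T> (p i) (p j)" and \<Omega>: "open \<Omega>"
  shows "stiffness_matrix \<Omega> \<phi> $ i $ j = 0"
proof -
  let ?f = "\<lambda>x. grad (\<phi> j) x \<bullet> grad (\<phi> i) x"
  have pij: "p i \<noteq> p j"
    using p ij by (auto simp: bij_betw_def inj_def)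
  have zero: "?f x = 0" if "x \<in> open_triangles \<T> \<Omega>" for x
  proof -
    from that obtain T where T: "T \<in> \<T>" "x \<in> interior T"
      by (auto simp: open_triangles_def)
    from \<T> T(1) obtain C where C: "\<not> affine_dependent C" "T = convex hull C"
      by (rule triangulation_of_simplexE)
    have "\<not> (p i \<in> C \<and> p j \<in> C)"
    proof
      assume "p i \<in> C \<and> p j \<in> C"
      \<comment> \<open>Faces of a simplex are the hulls of subsets of its vertices, so two distinct
        vertices span a one-dimensional face, that is, an edge.\<close>
      then have "\<exists>c\<subseteq>C. convex hull {p i, p j} = convex hull c"
        by (intro exI[of _ "{p i, p j}"]) simp
      then have "convex hull {p i, p j} face_of T"
        unfolding C(2) face_of_convex_hull_affine_independent[OF C(1)] .
      then have "closed_segment (p i) (p j) edge_of T"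
        using pij by (simp add: edge_of_def segment_convex_hull aff_dim_convex_hull aff_dim_2)
      then show False
        using ij pij T by (auto simp: neighbors_def)
    qed
    then obtain k where k: "k = i \<or> k = j" "\<not> p k extreme_point_of T"
      using C extreme_point_of_convex_hull_affine_independent by blast
    have "\<phi> k y = 0 \<bullet> y + 0" if "y \<in> T" for y
      using nodal_basis_zero_on_triangle[OF \<T> p \<phi> T(1) k(2) that] by simp
    then have "grad (\<phi> k) x = 0"
      using T(2) by (rule grad_affine_on)
    then show ?thesis using k by auto
  qed
  have "set_integrable lebesgue \<Omega> ?f"
    using \<phi> by (intro grad_inner_integrable[OF \<Omega> \<T>]) (auto simp: nodal_basis_def)
  \<comment> \<open>In the gauge integral the integrand may be replaced by 0 off a null set, which
    disposes of the unspecified gradients on edges.\<close>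
  then have "stiffness_matrix \<Omega> \<phi> $ i $ j = integral \<Omega> ?f"
    by (simp add: stiffness_matrix_def set_lebesgue_integral_eq_integral)
  also have "\<dots> = integral \<Omega> (\<lambda>x. 0 :: real)"
    by (rule integral_spike[OF negligible_diff_open_triangles[OF \<T>]]) (use zero in auto)
  finally show ?thesis by simp
qed


section \<open>Nonnegativity of the solution matrices\<close>

theorem theorem4p3:
  fixes P :: "real \<Rightarrow> real"
    and \<Omega> :: "(real^2) set" and \<T> :: "(real^2) set set"
    and p :: "'n::finite \<Rightarrow> real^2" and \<phi> :: "'n \<Rightarrow> real^2 \<Rightarrow> real"
    and B :: "(real^2 \<Rightarrow> real) \<Rightarrow> (real^2 \<Rightarrow> real) \<Rightarrow> real"
    and \<tau> :: real and \<omega> :: "nat \<Rightarrow> real"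
    and S M :: "real^'n^'n"
  assumes "S = stiffness_matrix \<Omega> \<phi>" and "M = mass_matrix B \<phi>"
    and "multi_term P \<or> distributed_order P"
    and "polygonal_domain \<Omega>" and "triangulation_of \<T> \<Omega>"
    and "bij_betw p UNIV (interior_nodes \<T> \<Omega>)"
    and "nodal_basis \<T> \<Omega> p \<phi>"
    and "inner_product_on (fe_space \<T> \<Omega>) B"
    and "\<And>i j. i \<noteq> j \<Longrightarrow> (i, j) \<notin> neighbor_pairs \<T> p \<Longrightarrow> M $ i $ j = 0"
    and "\<And>i j. (i, j) \<in> neighbor_pairs \<T> p \<Longrightarrow> S $ i $ j < 0"
    and "\<And>i j. (i, j) \<in> neighbor_pairs \<T> p \<Longrightarrow> M $ i $ j > 0"
    and "\<tau> > 0"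
    and "convolution_weights P \<tau> \<omega>"
    and "neighbor_pairs \<T> p \<noteq> {} \<Longrightarrow>
           P (1 / \<tau>) \<le> Min ((\<lambda>(i, j). \<bar>S $ i $ j\<bar> / M $ i $ j) ` neighbor_pairs \<T> p)"
  shows "\<forall>n\<ge>1. \<forall>i j. 0 \<le> solution_matrix \<omega> (matrix_inv M ** S) n $ i $ j"
proof (intro allI impI)
  fix n i j
  have \<Omega>: "open \<Omega>"
    using assms(4) by (simp add: polygonal_domain_def)
  have \<phi>: "\<phi> i \<in> fe_space \<T> \<Omega>" for i
    using assms(7) by (simp add: nodal_basis_def)
  have P_pos: "0 < P z" if "0 < z" for z
    using assms(3) that multi_term_pos distributed_order_pos by blast
  have neg: "\<omega> (Suc j) \<le> 0" for j
    using assms(3,12,13) multi_term_weights_nonpos distributed_order_weights_nonpos by blast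
  have part: "0 \<le> (\<Sum>j<n. \<omega> j)" if "1 \<le> n" for n
    using assms(12,13) P_pos neg that by (intro weights_partial_sum_nonneg) (auto intro: less_imp_le)
  have \<omega>0: "\<omega> 0 = P (1 / \<tau>)" "0 < \<omega> 0"
    using convolution_weights_0[OF assms(13)] P_pos assms(12) by auto
  have M: "0 < x \<bullet> (M *v x)" if "x \<noteq> 0" for x
    unfolding assms(2) using assms(8,7) that by (rule mass_matrix_pos_def)
  have M_nonneg: "0 \<le> M $ i $ j" for i j
  proof (cases "i = j")
    case True
    then show ?thesis
      unfolding assms(2) using mass_matrix_diag_pos[OF assms(8,7), of i] by simp
  next
    case False
    then show ?thesis using assms(9,11)[of i j] by fastforce
  qed
  have A: "0 < x \<bullet> ((\<omega> 0 *\<^sub>R M + S) *v x)" if "x \<noteq> 0" for x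
  proof -
    \<comment> \<open>Strictness comes from the mass term, as \<omega>_0 is positive; the stiffness
      term only has to be nonnegative.\<close>
    have "0 < \<omega> 0 * (x \<bullet> (M *v x))"
      using M \<omega>0 that by simp
    moreover have "0 \<le> x \<bullet> (S *v x)"
      unfolding assms(1) by (intro stiffness_matrix_pos_semidef[OF \<Omega> assms(5)] \<phi>)
    ultimately show ?thesis
      by (simp add: matrix_vector_mult_add_rdistrib scaleR_matrix_vector_assoc[symmetric] inner_add_right)
  qed
  have off: "\<omega> 0 * M $ i $ j + S $ i $ j \<le> 0" if "i \<noteq> j" for i j
  proof (cases "(i, j) \<in> neighbor_pairs \<T> p")
    case True
    let ?Q = "(\<lambda>(i, j). \<bar>S $ i $ j\<bar> / M $ i $ j) ` neighbor_pairs \<T> p"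
    \<comment> \<open>The pair at hand witnesses that the minimum ranges over a nonempty
      set.\<close>
    have "\<omega> 0 \<le> Min ?Q"
      unfolding \<omega>0(1) using True by (intro assms(14)) auto
    also have "\<dots> \<le> \<bar>S $ i $ j\<bar> / M $ i $ j"
      using True by (intro Min_le) (auto intro: rev_image_eqI)
    finally show ?thesis
      using assms(10,11)[OF True] by (simp add: field_simps)
  next
    case False
    then have "S $ i $ j = 0"
      unfolding assms(1) using that \<Omega>
      by (intro stiffness_matrix_non_neighbors[OF assms(5,6,7)]) (auto simp: neighbor_pairs_def)
    then show ?thesis using assms(9)[OF that False] by simp
  qed
  \<comment> \<open>Column \<open>j\<close> of the solution matrix is the scheme started from the
    unit vector \<open>axis j 1\<close>, which is nonnegative.\<close>
  have "0 \<le> scheme \<omega> (matrix_inv M ** S) (axis j 1) n $ i"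
    by (rule scheme_nonneg[OF M M_nonneg A off neg part]) (auto simp: axis_def)
  then show "0 \<le> solution_matrix \<omega> (matrix_inv M ** S) n $ i $ j"
    by (simp add: solution_matrix_works matrix_vector_mult_basis column_def)
qed

end
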